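(* (i) Let $m\ge 1$ be an integer. If there is a constant $C<\infty$ such that $\|A_N^{m,1}f\|_{L^2(\mathbb{R}^2)}\le C\|f\|_{L^2(\mathbb{R}^2)}$ for all measurable functions $N:\mathbb{R}\to\mathbb{R}$ and all Schwartz functions $f$ on $\mathbb{R}^2$, then the one-dimensional Carleson operator $\mathscr{C}$ is bounded on $L^2(\mathbb{R})$. (ii) Let $m\ge 1$ be an odd integer. If there is a constant $C<\infty$ such that $\|B_N^{m,m}f\|_{L^2(\mathbb{R}^2)}\le C\|f\|_{L^2(\mathbb{R}^2)}$ for all measurable functions $N:\mathbb{R}\to\mathbb{R}$ and all Schwartz functions $f$ on $\mathbb{R}^2$, then the one-dimensional Carleson operator $\mathscr{C}$ is bounded on $L^2(\mathbb{R})$.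
   Context: For positive integers $m,d$, a real number $\lambda$ and a Schwartz function $f$ on $\mathbb{R}^2$, let $$H^{m,d}_{\lambda} f(x,y)=\mathrm{p.v.}\int_{\mathbb{R}} f(x-t,y-t^m)\,e^{i\lambda t^d}\,\frac{dt}{t}.$$ For a measurable function $N:\mathbb{R}\to\mathbb{R}$ define $$A_N^{m,d}f(x,y)=H^{m,d}_{N(x)}f(x,y),\qquad B_N^{m,d}f(x,y)=H^{m,d}_{N(y)}f(x,y).$$ The one-dimensional Carleson operator is, for (initially Schwartz) functions $f$ on $\mathbb{R}$, $$\mathscr{C}f(x)=\sup_{\lambda\in\mathbb{R}}\Big|\mathrm{p.v.}\int_{\mathbb{R}} f(x-t)\,e^{i\lambda t}\,\frac{dt}{t}\Big|.$$ *)

theory Defs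
  imports "HOL-Analysis.Analysis"
begin

fun iter_partial :: "'a::euclidean_space list \<Rightarrow> ('a \<Rightarrow> complex) \<Rightarrow> 'a \<Rightarrow> complex" where
  "iter_partial [] f = f"
| "iter_partial (b # bs) f = (\<lambda>x. frechet_derivative (iter_partial bs f) (at x) b)"

text \<open>Differentiability of every iterated partial derivative at every point is smoothness, so
  \<^const>\<open>frechet_derivative\<close> is never evaluated outside its meaningful range below.\<close>

definition schwartz :: "('a::euclidean_space \<Rightarrow> complex) \<Rightarrow> bool" where
  "schwartz f \<longleftrightarrow> (\<forall>bs. set bs \<subseteq> Basis \<longrightarrow>
     (\<forall>x. iter_partial bs f differentiable (at x)) \<and>
     (\<forall>k::nat. \<exists>M::real. \<forall>x. norm x ^ k * norm (iter_partial bs f x) \<le> M))"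

text \<open>The \<open>L\<^sup>2\<close> norm of a nonnegative extended-real function with respect to Lebesgue measure;
  for complex \<open>f\<close> it is applied to \<open>\<bar>f\<bar>\<close>.\<close>

definition L2_norm :: "('a::euclidean_space \<Rightarrow> ennreal) \<Rightarrow> ennreal" where
  "L2_norm g = (let I = (\<integral>\<^sup>+ x. (g x)\<^sup>2 \<partial>lebesgue)
                in if I = \<infinity> then \<infinity> else ennreal (sqrt (enn2real I)))"

abbreviation L2_norm_complex :: "('a::euclidean_space \<Rightarrow> complex) \<Rightarrow> ennreal" where
  "L2_norm_complex f \<equiv> L2_norm (\<lambda>x. ennreal (norm (f x)))"

text \<open>Principal value at the singularity \<open>0\<close> only. For the integrands below, with Schwartz \<open>f\<close>,
  the truncated integrals converge absolutely and the limit exists, so the default value of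
  \<^const>\<open>Lim\<close> plays no role.\<close>

definition pv_integral :: "(real \<Rightarrow> complex) \<Rightarrow> complex" where
  "pv_integral F = Lim (at_right 0) (\<lambda>\<epsilon>::real. LINT t:{t. \<epsilon> < \<bar>t\<bar>}|lborel. F t)"

definition H_op :: "nat \<Rightarrow> nat \<Rightarrow> real \<Rightarrow> (real \<times> real \<Rightarrow> complex) \<Rightarrow> real \<times> real \<Rightarrow> complex" where
  "H_op m d lam f = (\<lambda>(x, y). pv_integral
     (\<lambda>t. f (x - t, y - t ^ m) * exp (\<i> * complex_of_real (lam * t ^ d)) / complex_of_real t))"

definition A_op :: "nat \<Rightarrow> nat \<Rightarrow> (real \<Rightarrow> real) \<Rightarrow> (real \<times> real \<Rightarrow> complex) \<Rightarrow> real \<times> real \<Rightarrow> complex" where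
  "A_op m d N f = (\<lambda>(x, y). H_op m d (N x) f (x, y))"

definition B_op :: "nat \<Rightarrow> nat \<Rightarrow> (real \<Rightarrow> real) \<Rightarrow> (real \<times> real \<Rightarrow> complex) \<Rightarrow> real \<times> real \<Rightarrow> complex" where
  "B_op m d N f = (\<lambda>(x, y). H_op m d (N y) f (x, y))"

text \<open>The supremum is taken in \<open>[0, \<infinity>]\<close>, so no boundedness in \<open>lam\<close> is presupposed.\<close>

definition carleson :: "(real \<Rightarrow> complex) \<Rightarrow> real \<Rightarrow> ennreal" where
  "carleson f x = (SUP lam::real. ennreal (norm (pv_integral
     (\<lambda>t. f (x - t) * exp (\<i> * complex_of_real (lam * t)) / complex_of_real t))))"

text \<open>Boundedness on \<open>L\<^sup>2(\<real>)\<close> of an operator initially given on Schwartz functions: the a priori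
  estimate on that dense class.\<close>

definition bounded_on_L2 :: "((real \<Rightarrow> complex) \<Rightarrow> real \<Rightarrow> ennreal) \<Rightarrow> bool" where
  "bounded_on_L2 T \<longleftrightarrow> (\<exists>C::ennreal. C < \<infinity> \<and> (\<forall>f. schwartz f \<longrightarrow>
     T f \<in> borel_measurable lebesgue \<and> L2_norm (T f) \<le> C * L2_norm_complex f))"

end

theory Submission
  imports Defs "HOL-Probability.Sinc_Integral"
begin

text \<open>
  The Carleson operator is recovered from the planar operators by testing them on tensor products
  that are almost constant in one of the two variables. Let \<open>g\<close> be a Schwartz function on the line
  and \<open>0 < c \<le> 1\<close>. Applied to \<open>F(x, y) = g(x) g(c y)\<close>, the operator of part (i) gives, with
  \<open>u = c y\<close>, \<open>p = 1\<close> and \<open>q = m\<close>,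
  \[ \mathrm{p.v.}\int g(x - t^p)\, g(u - c t^q)\, e^{i N(x) t^p}\, \frac{dt}{t}, \]
  and the operator of part (ii), applied to \<open>F(x, y) = g(c x) g(y)\<close>, gives the same expression with
  \<open>p = m\<close>, \<open>q = 1\<close>, \<open>y\<close> in the place of \<open>x\<close> and \<open>u = c x\<close>. Both parts are therefore one
  statement about this integral (\<open>H_op_tensor_scaled_second\<close>, \<open>H_op_tensor_scaled_first\<close>), in which
  the exponent \<open>p\<close> is odd. Rescaling the flat variable multiplies both sides of the squared
  \<open>L\<^sup>2\<close> inequality by the same factor, so the hypothesis bounds the norm in \<open>(x, u)\<close> of the integral by
  \<open>C \<parallel>g\<parallel>\<^sup>2\<close>, uniformly in \<open>c\<close>.

  As \<open>c\<close> tends to \<open>0\<close> the integral tends pointwise to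
  \<open>g(u)\<close> times the modulated Hilbert transform along \<open>t^p\<close>; for odd \<open>p\<close> the substitution
  \<open>s = t^p\<close>, under which \<open>dt / t = ds / (p s)\<close>, turns the latter into \<open>1 / p\<close> times the modulated
  Hilbert transform of \<open>g\<close> at frequency \<open>N(x)\<close> (\<open>twisted_limit\<close>). Fatou's lemma and division by
  \<open>\<parallel>g\<parallel>\<^sup>2\<close> then bound the linearized Carleson operator by \<open>p C\<close>, uniformly in \<open>N\<close>
  (\<open>carleson_square_bound\<close>). Finally, the supremum over all frequencies is a supremum over the
  rationals, which is approached monotonically by measurable choices of the frequency
  (\<open>linearized_SUP_bound\<close>).

  All limits and measurability questions about principal values are settled by the identity
  \[ \mathrm{p.v.}\int \phi(t)\, \frac{dt}{t} = \int_0^\infty \frac{\phi(t) - \phi(-t)}{t}\, dt, \]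
  whose right-hand side converges absolutely for the functions that occur.
\<close>

section \<open>Principal values as absolutely convergent integrals\<close>

text \<open>A single constant controls the decay at infinity and the odd part near \<open>0\<close>, so that one
  integrable majorant serves a whole family of functions in dominated convergence.\<close>

definition pv_controlled :: "real \<Rightarrow> (real \<Rightarrow> complex) \<Rightarrow> bool" where
  "pv_controlled A \<phi> \<longleftrightarrow> \<phi> \<in> borel_measurable borel \<and>
     (\<forall>t. norm (\<phi> t) \<le> A / (1 + t\<^sup>2)) \<and>
     (\<forall>t\<in>{0..1}. norm (\<phi> t - \<phi> (- t)) \<le> A * t)"

definition half_line_integral :: "(real \<Rightarrow> complex) \<Rightarrow> complex" where
  "half_line_integral \<phi> = (LINT t:{0<..}|lborel. (\<phi> t - \<phi> (- t)) / complex_of_real t)"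

lemma pv_controlledI [intro?]:
  assumes "\<phi> \<in> borel_measurable borel" "\<And>t. norm (\<phi> t) \<le> A / (1 + t\<^sup>2)"
    "\<And>t. 0 \<le> t \<Longrightarrow> t \<le> 1 \<Longrightarrow> norm (\<phi> t - \<phi> (- t)) \<le> A * t"
  shows "pv_controlled A \<phi>"
  using assms unfolding pv_controlled_def by auto

lemma pv_controlled_measurable [measurable_dest]:
  "pv_controlled A \<phi> \<Longrightarrow> \<phi> \<in> borel_measurable borel"
  unfolding pv_controlled_def by auto

lemma integrable_const_over_1_plus_square: "integrable lborel (\<lambda>t::real. a / (1 + t\<^sup>2))"
proof -
  have "integrable lborel (\<lambda>t::real. inverse (1 + t\<^sup>2))"
    using integrable_inverse_1_plus_square by (simp add: set_integrable_def)
  from integrable_mult_right[OF this, of a] show ?thesis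
    by (simp add: divide_inverse)
qed

lemma pv_controlled_nonneg: "pv_controlled A \<phi> \<Longrightarrow> 0 \<le> A"
  using norm_ge_zero[of "\<phi> 0"] unfolding pv_controlled_def
  by (metis add_0_right div_by_1 order_trans power_zero_numeral)

text \<open>The odd part handles \<open>t \<le> 1\<close>, where \<open>1 + t\<^sup>2 \<le> 2\<close>; the decay handles \<open>t > 1\<close>.\<close>
lemma pv_controlled_quotient_bound:
  assumes "pv_controlled A \<phi>" "0 < t"
  shows "norm ((\<phi> t - \<phi> (- t)) / complex_of_real t) \<le> 2 * A / (1 + t\<^sup>2)"
proof (cases "t \<le> 1")
  case True
  have A: "0 \<le> A" by (rule pv_controlled_nonneg[OF assms(1)])
  have "norm ((\<phi> t - \<phi> (- t)) / complex_of_real t) \<le> A"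
    using assms True unfolding pv_controlled_def
    by (auto simp: norm_divide divide_le_eq)
  also have "t\<^sup>2 \<le> 1" using assms True by (simp add: power_le_one)
  then have "A * (1 + t\<^sup>2) \<le> A * 2" using A by (intro mult_left_mono) auto
  then have "A \<le> 2 * A / (1 + t\<^sup>2)"
    by (subst pos_le_divide_eq) (auto simp: add_pos_nonneg)
  finally show ?thesis .
next
  case False
  have "norm (\<phi> t - \<phi> (- t)) \<le> norm (\<phi> t) + norm (\<phi> (- t))"
    by (rule norm_triangle_ineq4)
  also have "\<dots> \<le> A / (1 + t\<^sup>2) + A / (1 + t\<^sup>2)"
    using assms(1) unfolding pv_controlled_def by (metis add_mono power2_minus)
  finally have "norm (\<phi> t - \<phi> (- t)) \<le> 2 * A / (1 + t\<^sup>2)" by simp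
  moreover have "norm ((\<phi> t - \<phi> (- t)) / complex_of_real t) \<le> norm (\<phi> t - \<phi> (- t))"
    using False by (simp add: norm_divide divide_le_eq mult_left_le mult_le_cancel_left1)
  ultimately show ?thesis by linarith
qed

lemma half_line_set_integrable:
  assumes "pv_controlled A \<phi>"
  shows "set_integrable lborel {0<..} (\<lambda>t. (\<phi> t - \<phi> (- t)) / complex_of_real t)"
  unfolding set_integrable_def
proof (rule Bochner_Integration.integrable_bound[OF integrable_const_over_1_plus_square[of "2 * A"]])
  have [measurable]: "\<phi> \<in> borel_measurable borel" using assms by auto
  show "(\<lambda>t. indicator {0<..} t *\<^sub>R ((\<phi> t - \<phi> (- t)) / complex_of_real t)) \<in> borel_measurable lborel"
    by measurable
  have "0 \<le> A" by (rule pv_controlled_nonneg[OF assms])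
  show "AE t in lborel. norm (indicator {0<..} t *\<^sub>R ((\<phi> t - \<phi> (- t)) / complex_of_real t))
           \<le> norm (2 * A / (1 + t\<^sup>2))"
    using pv_controlled_quotient_bound[OF assms] \<open>0 \<le> A\<close>
    by (intro AE_I2) (auto simp: indicator_def abs_of_nonneg)
qed

text \<open>Away from the singularity the integrand itself is integrable, so the negative half of the
  domain may be reflected onto the positive one.\<close>
lemma truncated_integral_eq_half_line:
  assumes \<phi>: "pv_controlled A \<phi>" and "0 < \<epsilon>"
  shows "(LINT t:{t. \<epsilon> < \<bar>t\<bar>}|lborel. \<phi> t / complex_of_real t)
       = (LINT t:{\<epsilon><..}|lborel. (\<phi> t - \<phi> (- t)) / complex_of_real t)"
proof -
  have [measurable]: "\<phi> \<in> borel_measurable borel" using assms by auto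
  have A: "0 \<le> A" by (rule pv_controlled_nonneg[OF \<phi>])
  let ?q = "\<lambda>t. \<phi> t / complex_of_real t"
  have int: "set_integrable lborel B ?q" if [measurable]: "B \<in> sets borel" and B: "B \<subseteq> {t. \<epsilon> < \<bar>t\<bar>}" for B
    unfolding set_integrable_def
  proof (rule Bochner_Integration.integrable_bound[OF integrable_const_over_1_plus_square[of "A / \<epsilon>"]])
    show "AE t in lborel. norm (indicator B t *\<^sub>R ?q t) \<le> norm (A / \<epsilon> / (1 + t\<^sup>2))"
    proof (intro AE_I2)
      fix t
      show "norm (indicator B t *\<^sub>R ?q t) \<le> norm (A / \<epsilon> / (1 + t\<^sup>2))"
      proof (cases "t \<in> B")
        case True
        then have t: "\<epsilon> < \<bar>t\<bar>" using B by auto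
        have "norm (?q t) \<le> (A / (1 + t\<^sup>2)) / \<epsilon>"
          unfolding norm_divide norm_of_real
          using t \<phi> \<open>0 < \<epsilon>\<close> A unfolding pv_controlled_def by (intro frac_le) auto
        then show ?thesis using A \<open>0 < \<epsilon>\<close> True by (simp add: abs_of_nonneg mult.commute)
      qed simp
    qed
  qed measurable
  have split: "{t. \<epsilon> < \<bar>t\<bar>} = {\<epsilon><..} \<union> {..<-\<epsilon>}" by auto
  have "(LINT t:{t. \<epsilon> < \<bar>t\<bar>}|lborel. ?q t)
      = (LINT t:{\<epsilon><..}|lborel. ?q t) + (LINT t:{..<-\<epsilon>}|lborel. ?q t)"
    unfolding split using \<open>0 < \<epsilon>\<close> by (intro set_integral_Un int) auto
  also have "(LINT t:{..<-\<epsilon>}|lborel. ?q t) = (LINT t:{\<epsilon><..}|lborel. ?q (- t))"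
    unfolding set_lebesgue_integral_def
    by (subst lborel_integral_real_affine[of "-1" _ 0])
       (auto intro!: Bochner_Integration.integral_cong simp: indicator_def)
  also have "(LINT t:{\<epsilon><..}|lborel. ?q t) + \<dots> = (LINT t:{\<epsilon><..}|lborel. ?q t + ?q (- t))"
  proof (rule set_integral_add(2)[symmetric])
    show "set_integrable lborel {\<epsilon><..} ?q" using \<open>0 < \<epsilon>\<close> by (intro int) auto
    have "set_integrable lborel {..<-\<epsilon>} ?q" using \<open>0 < \<epsilon>\<close> by (intro int) auto
    then show "set_integrable lborel {\<epsilon><..} (\<lambda>t. ?q (- t))"
      unfolding set_integrable_def
      by (subst (asm) lborel_integrable_real_affine_iff[of "-1" _ 0, symmetric])
         (auto elim!: Bochner_Integration.integrable_cong[THEN iffD1, rotated -1] simp: indicator_def)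
  qed
  also have "\<dots> = (LINT t:{\<epsilon><..}|lborel. (\<phi> t - \<phi> (- t)) / complex_of_real t)"
    by (simp add: diff_divide_distrib)
  finally show ?thesis .
qed

lemma pv_integral_eq_half_line:
  assumes \<phi>: "pv_controlled A \<phi>"
  shows "pv_integral (\<lambda>t. \<phi> t / complex_of_real t) = half_line_integral \<phi>"
proof -
  have [measurable]: "\<phi> \<in> borel_measurable borel" using assms by auto
  have A: "0 \<le> A" by (rule pv_controlled_nonneg[OF \<phi>])
  let ?F = "\<lambda>\<epsilon>. LINT t:{t. \<epsilon> < \<bar>t\<bar>}|lborel. \<phi> t / complex_of_real t"
  have "(?F \<longlongrightarrow> half_line_integral \<phi>) (at_right 0)"
  proof (rule tendsto_at_right_sequentially[of 0 1])
    fix S :: "nat \<Rightarrow> real"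
    assume S: "\<And>n. 0 < S n" "S \<longlonglongrightarrow> 0"
    have "(\<lambda>n. LINT t:{S n<..}|lborel. (\<phi> t - \<phi> (- t)) / complex_of_real t) \<longlonglongrightarrow> half_line_integral \<phi>"
      unfolding half_line_integral_def set_lebesgue_integral_def
    proof (rule integral_dominated_convergence[OF _ _ integrable_const_over_1_plus_square[of "2 * A"]])
      show "AE t in lborel. (\<lambda>n. indicator {S n<..} t *\<^sub>R ((\<phi> t - \<phi> (- t)) / complex_of_real t))
              \<longlonglongrightarrow> indicator {0<..} t *\<^sub>R ((\<phi> t - \<phi> (- t)) / complex_of_real t)"
      proof (intro AE_I2)
        fix t :: real
        have "eventually (\<lambda>n. indicator {S n<..} t = (indicator {0<..} t :: real)) sequentially"
        proof (cases "t > 0")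
          case True
          from order_tendstoD(2)[OF S(2) this] show ?thesis
            by eventually_elim (use True in \<open>auto simp: indicator_def\<close>)
        next
          case False
          then have "\<not> S n < t" for n using S(1)[of n] by linarith
          then show ?thesis using False by (auto simp: indicator_def)
        qed
        then show "(\<lambda>n. indicator {S n<..} t *\<^sub>R ((\<phi> t - \<phi> (- t)) / complex_of_real t))
              \<longlonglongrightarrow> indicator {0<..} t *\<^sub>R ((\<phi> t - \<phi> (- t)) / complex_of_real t)"
          by (intro tendsto_eventually) (auto elim: eventually_mono)
      qed
      show "AE t in lborel. norm (indicator {S n<..} t *\<^sub>R ((\<phi> t - \<phi> (- t)) / complex_of_real t))
              \<le> 2 * A / (1 + t\<^sup>2)" for n
        using pv_controlled_quotient_bound[OF \<phi>] A less_trans[OF S(1)[of n]]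
        by (intro AE_I2) (auto simp: indicator_def)
    qed measurable
    then show "(\<lambda>n. ?F (S n)) \<longlonglongrightarrow> half_line_integral \<phi>"
      by (simp add: truncated_integral_eq_half_line[OF \<phi> S(1)])
  qed simp
  then show ?thesis unfolding pv_integral_def by (intro tendsto_Lim) auto
qed

lemma half_line_integral_tendsto:
  assumes \<phi>: "\<And>n::nat. pv_controlled A (\<phi> n)" and lim: "\<And>t. (\<lambda>n. \<phi> n t) \<longlonglongrightarrow> \<psi> t"
  shows "(\<lambda>n. half_line_integral (\<phi> n)) \<longlonglongrightarrow> half_line_integral \<psi>"
  unfolding half_line_integral_def set_lebesgue_integral_def
proof (rule integral_dominated_convergence[OF _ _ integrable_const_over_1_plus_square[of "2 * A"]])
  have [measurable]: "\<phi> n \<in> borel_measurable borel" for n using \<phi> by auto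
  have [measurable]: "\<psi> \<in> borel_measurable borel"
    by (rule borel_measurable_LIMSEQ_metric[of \<phi>]) (use lim in auto)
  show "(\<lambda>t. indicator {0<..} t *\<^sub>R ((\<psi> t - \<psi> (- t)) / complex_of_real t)) \<in> borel_measurable lborel"
    by measurable
  show "(\<lambda>t. indicator {0<..} t *\<^sub>R ((\<phi> n t - \<phi> n (- t)) / complex_of_real t)) \<in> borel_measurable lborel" for n
    by measurable
  show "AE t in lborel. (\<lambda>n. indicator {0<..} t *\<^sub>R ((\<phi> n t - \<phi> n (- t)) / complex_of_real t))
          \<longlonglongrightarrow> indicator {0<..} t *\<^sub>R ((\<psi> t - \<psi> (- t)) / complex_of_real t)"
    unfolding divide_inverse by (intro AE_I2 tendsto_intros lim)
  show "AE t in lborel. norm (indicator {0<..} t *\<^sub>R ((\<phi> n t - \<phi> n (- t)) / complex_of_real t))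
          \<le> 2 * A / (1 + t\<^sup>2)" for n
    using pv_controlled_quotient_bound[OF \<phi>[of n]] pv_controlled_nonneg[OF \<phi>[of n]]
    by (intro AE_I2) (auto simp: indicator_def)
qed

text \<open>The substitution \<open>s = t^p\<close> on the half-line. Oddness of \<open>p\<close> is what makes
  \<open>\<phi>((-t)^p) = \<phi>(-(t^p))\<close>; for even \<open>p\<close> the left-hand side would vanish.\<close>
lemma half_line_integral_odd_power:
  assumes \<phi>: "pv_controlled A \<phi>" and p: "odd p"
  shows "half_line_integral (\<lambda>t. \<phi> (t ^ p)) = half_line_integral \<phi> / of_nat p"
proof -
  have p0: "p > 0" using p by (cases p) auto
  let ?f = "\<lambda>t. (\<phi> t - \<phi> (- t)) / complex_of_real t"
  let ?h = "\<lambda>t::real. real p * t ^ (p - 1)"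
  have img: "(\<lambda>t::real. t ^ p) ` {0<..} = {0<..}"
  proof (intro equalityI subsetI)
    fix s :: real assume "s \<in> {0<..}"
    then show "s \<in> (\<lambda>t::real. t ^ p) ` {0<..}"
      using p0 by (intro image_eqI[of _ _ "root p s"]) auto
  qed auto
  have f: "set_integrable lborel {0<..} ?f"
    by (rule half_line_set_integrable[OF \<phi>])
  have "?f absolutely_integrable_on {0<..}"
    using f by (simp add: set_integrable_def integrable_completion set_borel_measurable_def
      borel_measurable_integrable)
  moreover have fI: "integral {0<..} ?f = half_line_integral \<phi>"
    using set_borel_integral_eq_integral(2)[OF f] by (simp add: half_line_integral_def)
  ultimately have *: "(\<lambda>t. \<bar>?h t\<bar> *\<^sub>R ?f (t ^ p)) absolutely_integrable_on {0<..} \<and>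
      integral {0<..} (\<lambda>t. \<bar>?h t\<bar> *\<^sub>R ?f (t ^ p)) = half_line_integral \<phi>"
    by (subst has_absolute_integral_change_of_variables_real[where g="\<lambda>t. t ^ p" and h="?h"])
       (auto simp: img inj_on_def power_eq_iff_eq_base p0 intro!: derivative_eq_intros)
  have [measurable]: "\<phi> \<in> borel_measurable borel" using \<phi> by auto
  have eq: "\<bar>?h t\<bar> *\<^sub>R ?f (t ^ p) = of_nat p * ((\<phi> (t ^ p) - \<phi> ((- t) ^ p)) / complex_of_real t)"
    if "t \<in> {0<..}" for t
  proof -
    have "t ^ p = t * t ^ (p - 1)" using p0 by (cases p) auto
    then show ?thesis using that p by (simp add: scaleR_conv_of_real field_simps)
  qed
  have "half_line_integral \<phi> = (LINT t:{0<..}|lebesgue. \<bar>?h t\<bar> *\<^sub>R ?f (t ^ p))"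
    using * by (simp add: set_lebesgue_integral_eq_integral(2))
  also have "\<dots> = (LINT t:{0<..}|lborel. \<bar>?h t\<bar> *\<^sub>R ?f (t ^ p))"
    unfolding set_lebesgue_integral_def by (rule integral_completion) measurable
  also have "\<dots> = (LINT t:{0<..}|lborel. of_nat p * ((\<phi> (t ^ p) - \<phi> ((- t) ^ p)) / complex_of_real t))"
    by (rule set_lebesgue_integral_cong) (use eq in auto)
  also have "\<dots> = of_nat p * half_line_integral (\<lambda>t. \<phi> (t ^ p))"
    unfolding half_line_integral_def by (rule set_integral_mult_right)
  finally show ?thesis using p0 by simp
qed

section \<open>Schwartz functions and their scaled tensor products\<close>
lemma frechet_derivative_real_axis:
  fixes g :: "real \<Rightarrow> complex"
  assumes "g differentiable (at x)"
  shows "(g has_derivative (\<lambda>h. h *\<^sub>R frechet_derivative g (at x) 1)) (at x)"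
proof -
  have d: "(g has_derivative frechet_derivative g (at x)) (at x)"
    using assms by (simp add: frechet_derivative_works)
  interpret linear "frechet_derivative g (at x)" by (rule has_derivative_linear[OF d])
  have "frechet_derivative g (at x) h = h *\<^sub>R frechet_derivative g (at x) 1" for h
    using scale[of h 1] by simp
  then show ?thesis using d by (metis (no_types, lifting) ext)
qed

lemma schwartz_iter_differentiable:
  fixes g :: "real \<Rightarrow> complex"
  assumes "schwartz g"
  shows "iter_partial (replicate k 1) g differentiable (at x)"
proof -
  have "set (replicate k (1::real)) \<subseteq> Basis" by auto
  with assms show ?thesis unfolding schwartz_def by blast
qed

lemma schwartz_iter_decay:
  fixes g :: "real \<Rightarrow> complex"
  assumes "schwartz g"
  obtains M where "0 \<le> M" "\<And>x. \<bar>x\<bar> ^ j * norm (iter_partial (replicate k 1) g x) \<le> M"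
proof -
  have "set (replicate k (1::real)) \<subseteq> Basis" by auto
  with assms obtain M where M: "\<And>x::real. norm x ^ j * norm (iter_partial (replicate k 1) g x) \<le> M"
    unfolding schwartz_def by blast
  moreover have "0 \<le> M" using M[of 0] by (meson norm_ge_zero order_trans zero_le_mult_iff zero_le_power)
  ultimately show thesis using that by auto
qed

lemma schwartz_decay_lipschitz:
  fixes g :: "real \<Rightarrow> complex"
  assumes g: "schwartz g"
  obtains K where "0 \<le> K" "\<And>x. norm (g x) \<le> K / (1 + x\<^sup>2)"
    "\<And>x y. norm (g x - g y) \<le> K * \<bar>x - y\<bar>"
proof -
  obtain M0 where M0: "0 \<le> M0" "\<And>x. \<bar>x\<bar> ^ 0 * norm (iter_partial (replicate 0 1) g x) \<le> M0"
    using schwartz_iter_decay[OF g, where j=0 and k=0] by blast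
  obtain M2 where M2: "0 \<le> M2" "\<And>x. \<bar>x\<bar> ^ 2 * norm (iter_partial (replicate 0 1) g x) \<le> M2"
    using schwartz_iter_decay[OF g, where j=2 and k=0] by blast
  obtain M1 where M1: "0 \<le> M1" "\<And>x. \<bar>x\<bar> ^ 0 * norm (iter_partial (replicate 1 1) g x) \<le> M1"
    using schwartz_iter_decay[OF g, where j=0 and k=1] by blast
  show thesis
  proof (rule that[of "M0 + M2 + M1"])
    show "0 \<le> M0 + M2 + M1" using M0(1) M1(1) M2(1) by simp
  next
    fix x
    have "norm (g x) * (1 + x\<^sup>2) \<le> M0 + M2 + M1"
      using M0(2)[of x] M2(2)[of x] M1 by (simp add: algebra_simps)
    then show "norm (g x) \<le> (M0 + M2 + M1) / (1 + x\<^sup>2)"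
      by (subst pos_le_divide_eq) (auto simp: add_pos_nonneg)
  next
    fix x y
    have "norm (g x - g y) \<le> M1 * norm (x - y)"
    proof (rule differentiable_bound[of UNIV])
      fix z
      show "(g has_derivative (\<lambda>h. h *\<^sub>R frechet_derivative g (at z) 1)) (at z within UNIV)"
        using frechet_derivative_real_axis schwartz_iter_differentiable[OF g, of 0] by simp
      show "onorm (\<lambda>h. h *\<^sub>R frechet_derivative g (at z) 1) \<le> M1"
        using M1(2)[of z] M1(1) by (intro onorm_le) (auto simp: mult.commute[of M1] mult_left_mono)
    qed auto
    also have "\<dots> \<le> (M0 + M2 + M1) * \<bar>x - y\<bar>" using M0(1) M1(1) M2(1) by (intro mult_mono) auto
    finally show "norm (g x - g y) \<le> (M0 + M2 + M1) * \<bar>x - y\<bar>" .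
  qed
qed

lemma schwartz_continuous:
  fixes g :: "real \<Rightarrow> complex"
  assumes "schwartz g"
  shows "continuous_on A g"
  using schwartz_iter_differentiable[OF assms, of 0]
  by (auto intro!: continuous_at_imp_continuous_on differentiable_imp_continuous_within)

lemma schwartz_measurable [measurable_dest]:
  fixes g :: "real \<Rightarrow> complex"
  shows "schwartz g \<Longrightarrow> g \<in> borel_measurable borel"
  by (rule borel_measurable_continuous_onI) (rule schwartz_continuous)

definition scaled_tensor :: "real \<Rightarrow> real \<Rightarrow> (real \<Rightarrow> complex) \<Rightarrow> real \<times> real \<Rightarrow> complex" where
  "scaled_tensor a b g = (\<lambda>(x, y). g (a * x) * g (b * y))"

lemma scaled_tensor_has_derivative:
  fixes G H :: "real \<Rightarrow> complex"
  assumes "G differentiable (at (a * fst z))" "H differentiable (at (b * snd z))"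
  shows "((\<lambda>z. C * G (a * fst z) * H (b * snd z)) has_derivative
      (\<lambda>h. C * (a * fst h) *\<^sub>R frechet_derivative G (at (a * fst z)) 1 * H (b * snd z)
         + C * G (a * fst z) * (b * snd h) *\<^sub>R frechet_derivative H (at (b * snd z)) 1)) (at z)"
proof -
  have G: "((\<lambda>z. G (a * fst z)) has_derivative
      (\<lambda>h. (a * fst h) *\<^sub>R frechet_derivative G (at (a * fst z)) 1)) (at z)"
    by (rule has_derivative_compose[where f="\<lambda>z. a * fst z" and g=G, OF _ frechet_derivative_real_axis[OF assms(1)]])
       (auto intro!: derivative_eq_intros)
  have H: "((\<lambda>z. H (b * snd z)) has_derivative
      (\<lambda>h. (b * snd h) *\<^sub>R frechet_derivative H (at (b * snd z)) 1)) (at z)"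
    by (rule has_derivative_compose[where f="\<lambda>z. b * snd z" and g=H, OF _ frechet_derivative_real_axis[OF assms(2)]])
       (auto intro!: derivative_eq_intros)
  show ?thesis
    by (rule has_derivative_eq_rhs[OF has_derivative_mult[OF has_derivative_mult[OF has_derivative_const G] H]])
       (auto simp: algebra_simps)
qed

text \<open>Only the number of occurrences of each of the two basis vectors matters: each partial
  derivative acts on one factor and produces one factor \<open>a\<close> or \<open>b\<close>.\<close>
lemma iter_partial_scaled_tensor:
  fixes g :: "real \<Rightarrow> complex"
  assumes g: "schwartz g" and bs: "set bs \<subseteq> Basis"
  shows "iter_partial bs (scaled_tensor a b g) =
    (\<lambda>z. complex_of_real (a ^ count_list bs (1, 0) * b ^ count_list bs (0, 1))
        * iter_partial (replicate (count_list bs (1, 0)) 1) g (a * fst z)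
        * iter_partial (replicate (count_list bs (0, 1)) 1) g (b * snd z))"
  using bs
proof (induction bs)
  case Nil
  then show ?case by (auto simp: scaled_tensor_def)
next
  case (Cons e bs)
  let ?k = "count_list bs (1, 0)" and ?l = "count_list bs (0, 1)"
  let ?G = "iter_partial (replicate ?k 1) g" and ?H = "iter_partial (replicate ?l 1) g"
  define C where "C = complex_of_real (a ^ ?k * b ^ ?l)"
  have IH: "iter_partial bs (scaled_tensor a b g) = (\<lambda>z. C * ?G (a * fst z) * ?H (b * snd z))"
    using Cons by (auto simp: C_def)
  have fd: "frechet_derivative (\<lambda>z. C * ?G (a * fst z) * ?H (b * snd z)) (at z) =
     (\<lambda>h. C * (a * fst h) *\<^sub>R frechet_derivative ?G (at (a * fst z)) 1 * ?H (b * snd z)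
         + C * ?G (a * fst z) * (b * snd h) *\<^sub>R frechet_derivative ?H (at (b * snd z)) 1)" for z
    by (rule frechet_derivative_at[symmetric])
       (intro scaled_tensor_has_derivative schwartz_iter_differentiable g)
  from Cons.prems consider "e = (1, 0)" | "e = (0, 1)" by (auto simp: Basis_prod_def)
  then show ?case
    by cases (simp_all add: IH fd scaleR_conv_of_real, simp_all add: C_def algebra_simps)
qed

text \<open>Since \<open>\<bar>(x, y)\<bar>^j \<le> 2^j (\<bar>x\<bar>^j + \<bar>y\<bar>^j)\<close>, the polynomial weight can be given to one factor at
  a time while the other factor is merely bounded.\<close>
lemma schwartz_scaled_tensor:
  fixes g :: "real \<Rightarrow> complex"
  assumes g: "schwartz g" and a: "0 < a" and b: "0 < b"
  shows "schwartz (scaled_tensor a b g)"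
  unfolding schwartz_def
proof (intro allI impI conjI)
  fix bs :: "(real \<times> real) list" assume bs: "set bs \<subseteq> Basis"
  let ?k = "count_list bs (1, 0)" and ?l = "count_list bs (0, 1)"
  let ?G = "iter_partial (replicate ?k 1) g" and ?H = "iter_partial (replicate ?l 1) g"
  let ?C = "complex_of_real (a ^ ?k * b ^ ?l)"
  note eq = iter_partial_scaled_tensor[OF g bs]
  show "iter_partial bs (scaled_tensor a b g) differentiable (at z)" for z
    using scaled_tensor_has_derivative[OF schwartz_iter_differentiable[OF g] schwartz_iter_differentiable[OF g],
        where C="?C"]
    unfolding eq differentiable_def by blast
  show "\<exists>M. \<forall>z. norm z ^ j * norm (iter_partial bs (scaled_tensor a b g) z) \<le> M" for j
  proof -
    obtain P where P: "0 \<le> P" "\<And>x. \<bar>x\<bar> ^ 0 * norm (?G x) \<le> P"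
    using schwartz_iter_decay[OF g] by blast
    obtain Q where Q: "0 \<le> Q" "\<And>x. \<bar>x\<bar> ^ 0 * norm (?H x) \<le> Q"
    using schwartz_iter_decay[OF g] by blast
    obtain P' where P': "0 \<le> P'" "\<And>x. \<bar>x\<bar> ^ j * norm (?G x) \<le> P'"
    using schwartz_iter_decay[OF g] by blast
    obtain Q' where Q': "0 \<le> Q'" "\<And>x. \<bar>x\<bar> ^ j * norm (?H x) \<le> Q'"
    using schwartz_iter_decay[OF g] by blast
    have GP: "\<bar>x\<bar> ^ j * norm (?G (a * x)) \<le> P' / a ^ j" for x
      using P'(2)[of "a * x"] a by (simp add: field_simps abs_mult power_mult_distrib)
    have HQ: "\<bar>y\<bar> ^ j * norm (?H (b * y)) \<le> Q' / b ^ j" for y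
      using Q'(2)[of "b * y"] b by (simp add: field_simps abs_mult power_mult_distrib)
    show ?thesis
    proof (intro exI allI)
      fix z :: "real \<times> real"
      obtain x y where z: "z = (x, y)" by (cases z)
      have "norm z \<le> \<bar>x\<bar> + \<bar>y\<bar>" unfolding z using norm_Pair_le[of x y] by simp
      also have "\<dots> \<le> 2 * max \<bar>x\<bar> \<bar>y\<bar>" by linarith
      finally have "norm z ^ j \<le> (2 * max \<bar>x\<bar> \<bar>y\<bar>) ^ j" by (intro power_mono) auto
      also have "\<dots> \<le> 2 ^ j * (\<bar>x\<bar> ^ j + \<bar>y\<bar> ^ j)"
        unfolding power_mult_distrib by (auto simp: max_def)
      finally have z_le: "norm z ^ j \<le> 2 ^ j * (\<bar>x\<bar> ^ j + \<bar>y\<bar> ^ j)" .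
      have "norm z ^ j * (norm (?G (a * x)) * norm (?H (b * y)))
          \<le> 2 ^ j * (\<bar>x\<bar> ^ j + \<bar>y\<bar> ^ j) * (norm (?G (a * x)) * norm (?H (b * y)))"
        using z_le by (intro mult_right_mono) auto
      also have "\<dots> = 2 ^ j * ((\<bar>x\<bar> ^ j * norm (?G (a * x))) * norm (?H (b * y))
                + norm (?G (a * x)) * (\<bar>y\<bar> ^ j * norm (?H (b * y))))" by (simp add: algebra_simps)
      also have "\<dots> \<le> 2 ^ j * ((P' / a ^ j) * Q + P * (Q' / b ^ j))"
        using P Q P' Q' a b GP HQ by (intro mult_left_mono add_mono mult_mono) auto
      finally have "norm ?C * (norm z ^ j * (norm (?G (a * x)) * norm (?H (b * y))))
          \<le> norm ?C * (2 ^ j * ((P' / a ^ j) * Q + P * (Q' / b ^ j)))"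
        by (rule mult_left_mono) simp
      then show "norm z ^ j * norm (iter_partial bs (scaled_tensor a b g) z)
          \<le> norm ?C * (2 ^ j * ((P' / a ^ j) * Q + P * (Q' / b ^ j)))"
        unfolding eq by (simp add: z norm_mult mult_ac)
    qed
  qed
qed

section \<open>The integrands common to both parts\<close>
definition modulated :: "(real \<Rightarrow> complex) \<Rightarrow> real \<Rightarrow> real \<Rightarrow> real \<Rightarrow> complex" where
  "modulated g lam x s = g (x - s) * exp (\<i> * complex_of_real (lam * s))"

text \<open>The integrand, up to the factor \<open>1 / t\<close>, that both planar operators produce on a scaled tensor
  product: the variable \<open>x\<close> is translated along \<open>t^p\<close> and carries the modulation, while \<open>u\<close> is the
  rescaled variable, whose translation disappears as \<open>c\<close> tends to \<open>0\<close>.\<close>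
definition twisted ::
  "nat \<Rightarrow> nat \<Rightarrow> (real \<Rightarrow> complex) \<Rightarrow> real \<Rightarrow> real \<Rightarrow> real \<Rightarrow> real \<Rightarrow> real \<Rightarrow> complex" where
  "twisted p q g c lam x u t = g (u - c * t ^ q) * modulated g lam x (t ^ p)"

lemma modulated_measurable [measurable (raw)]:
  assumes [measurable]: "g \<in> borel_measurable borel"
    "lam \<in> borel_measurable M" "x \<in> borel_measurable M" "s \<in> borel_measurable M"
  shows "(\<lambda>z. modulated g (lam z) (x z) (s z)) \<in> borel_measurable M"
  unfolding modulated_def by measurable

lemma abs_power_diff_le:
  fixes t :: real
  assumes "0 \<le> t" "t \<le> 1" "1 \<le> k"
  shows "\<bar>t ^ k - (- t) ^ k\<bar> \<le> 2 * t"
proof -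
  have "t ^ k \<le> t" using power_decreasing[of 1 k t] assms by simp
  then show ?thesis using assms by (cases "even k") auto
qed

lemma norm_cis_diff_le: "norm (exp (\<i> * complex_of_real a) - exp (\<i> * complex_of_real b)) \<le> \<bar>a - b\<bar>"
proof -
  have "exp (\<i> * complex_of_real a) - exp (\<i> * complex_of_real b)
      = exp (\<i> * complex_of_real b) * (exp (\<i> * complex_of_real (a - b)) - 1)"
    by (simp add: right_diff_distrib exp_diff)
  then have "norm (exp (\<i> * complex_of_real a) - exp (\<i> * complex_of_real b)) = 2 * \<bar>sin ((a - b) / 2)\<bar>"
    by (simp only: norm_mult norm_exp_i_times dist_exp_i_1)
  then show ?thesis using abs_sin_x_le_abs_x[of "(a - b) / 2"] by simp
qed

text \<open>Translation by \<open>x\<close> costs a factor \<open>2 (1 + x\<^sup>2)\<close>, and \<open>\<bar>t\<bar> \<le> \<bar>t^p\<bar>\<close> off the unit interval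
  shows that composition with the power preserves quadratic decay.\<close>
lemma modulated_decay:
  assumes K: "0 \<le> K" "\<And>x. norm (g x) \<le> K / (1 + x\<^sup>2)" and p: "1 \<le> p"
  shows "norm (modulated g lam x (t ^ p)) \<le> 4 * K * (1 + x\<^sup>2) / (1 + t\<^sup>2)"
proof -
  have "1 + t\<^sup>2 \<le> 2 * (1 + (t ^ p)\<^sup>2)"
  proof (cases "\<bar>t\<bar> \<le> 1")
    case True
    then have "t\<^sup>2 \<le> 1" by (simp add: abs_square_le_1)
    then have "1 + t\<^sup>2 \<le> 2 * (1 + 0)" by simp
    also have "\<dots> \<le> 2 * (1 + (t ^ p)\<^sup>2)" by (intro mult_left_mono add_left_mono) auto
    finally show ?thesis .
  next
    case False
    then have "1 \<le> t\<^sup>2" using one_le_power[of "\<bar>t\<bar>" 2] by simp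
    then have "(t\<^sup>2) ^ 1 \<le> (t\<^sup>2) ^ p" by (intro power_increasing p)
    also have "(t\<^sup>2) ^ p = (t ^ p)\<^sup>2" by (simp flip: power_mult add: mult.commute)
    finally have "1 + t\<^sup>2 \<le> 1 + (t ^ p)\<^sup>2" by simp
    also have "\<dots> \<le> 2 * (1 + (t ^ p)\<^sup>2)" unfolding mult_2 by (rule add_increasing2) auto
    finally show ?thesis .
  qed
  also have "1 + (t ^ p)\<^sup>2 \<le> 2 * (1 + x\<^sup>2) * (1 + (x - t ^ p)\<^sup>2)"
  proof -
    have "2 * (1 + x\<^sup>2) * (1 + (x - t ^ p)\<^sup>2) - (1 + (t ^ p)\<^sup>2)
        = 1 + (2 * x - t ^ p)\<^sup>2 + 2 * x\<^sup>2 * (x - t ^ p)\<^sup>2"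
      by (simp add: power2_eq_square algebra_simps)
    moreover have "0 \<le> 1 + (2 * x - t ^ p)\<^sup>2 + 2 * x\<^sup>2 * (x - t ^ p)\<^sup>2"
      by (intro add_nonneg_nonneg mult_nonneg_nonneg) auto
    ultimately show ?thesis by linarith
  qed
  finally have "1 + t\<^sup>2 \<le> 4 * (1 + x\<^sup>2) * (1 + (x - t ^ p)\<^sup>2)" by (simp add: algebra_simps)
  from mult_left_mono[OF this K(1)]
  have "K * (1 + t\<^sup>2) \<le> 4 * K * (1 + x\<^sup>2) * (1 + (x - t ^ p)\<^sup>2)" by (simp only: mult_ac)
  moreover have "0 < 1 + t\<^sup>2" "0 < 1 + (x - t ^ p)\<^sup>2" by (auto simp: add_pos_nonneg)
  ultimately have "K / (1 + (x - t ^ p)\<^sup>2) \<le> 4 * K * (1 + x\<^sup>2) / (1 + t\<^sup>2)"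
    by (simp only: pos_divide_le_eq times_divide_eq_left pos_le_divide_eq)
  moreover have "norm (modulated g lam x (t ^ p)) = norm (g (x - t ^ p))"
    by (simp add: modulated_def norm_mult)
  ultimately show ?thesis using K(2)[of "x - t ^ p"] by simp
qed

text \<open>Boundedness, Lipschitz continuity and quadratic decay of \<open>g\<close> are all that the estimates need,
  and the bound depends on \<open>h\<close> only through \<open>M\<close>. The constant function \<open>h = 1\<close> gives the Carleson
  integrand, and \<open>h(t) = g(u - c t^q)\<close> gives the twisted integrand uniformly in \<open>c\<close>.\<close>
lemma pv_controlled_modulated:
  assumes K: "0 \<le> K" "\<And>x. norm (g x) \<le> K / (1 + x\<^sup>2)" "\<And>x y. norm (g x - g y) \<le> K * \<bar>x - y\<bar>"
    and g: "g \<in> borel_measurable borel"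
    and h: "h \<in> borel_measurable borel" "\<And>t. norm (h t) \<le> M"
      "\<And>t. 0 \<le> t \<Longrightarrow> t \<le> 1 \<Longrightarrow> norm (h t - h (- t)) \<le> 2 * M * t"
    and p: "1 \<le> p" and lam: "\<bar>lam\<bar> \<le> \<Lambda>"
  shows "pv_controlled (4 * K * M * (1 + x\<^sup>2 + \<Lambda>)) (\<lambda>t. h t * modulated g lam x (t ^ p))"
proof
  note [measurable] = g h(1)
  show "(\<lambda>t. h t * modulated g lam x (t ^ p)) \<in> borel_measurable borel" by measurable
  have M: "0 \<le> M" using h(2)[of 0] norm_ge_zero order_trans by blast
  have \<Lambda>: "0 \<le> \<Lambda>" using lam by linarith
  have gK: "norm (g y) \<le> K" for y
  proof -
    have "K / (1 + y\<^sup>2) \<le> K" using K(1) by (simp add: divide_le_eq mult_le_cancel_left1 add_pos_nonneg)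
    then show ?thesis using K(2)[of y] by linarith
  qed
  have mK: "norm (modulated g lam x s) \<le> K" for s using gK by (simp add: modulated_def norm_mult)
  show "norm (h t * modulated g lam x (t ^ p)) \<le> 4 * K * M * (1 + x\<^sup>2 + \<Lambda>) / (1 + t\<^sup>2)" for t
  proof -
    have "norm (h t * modulated g lam x (t ^ p)) \<le> M * (4 * K * (1 + x\<^sup>2) / (1 + t\<^sup>2))"
      unfolding norm_mult by (intro mult_mono h(2) modulated_decay K p M) auto
    also have "\<dots> = 4 * K * M * (1 + x\<^sup>2) / (1 + t\<^sup>2)" by simp
    also have "\<dots> \<le> 4 * K * M * (1 + x\<^sup>2 + \<Lambda>) / (1 + t\<^sup>2)"
      using K(1) M \<Lambda> by (intro divide_right_mono mult_left_mono) auto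
    finally show ?thesis .
  qed
  show "norm (h t * modulated g lam x (t ^ p) - h (- t) * modulated g lam x ((- t) ^ p))
      \<le> 4 * K * M * (1 + x\<^sup>2 + \<Lambda>) * t" if t: "0 \<le> t" "t \<le> 1" for t
  proof -
    let ?s = "t ^ p" and ?r = "(- t) ^ p"
    have sr: "\<bar>?s - ?r\<bar> \<le> 2 * t" by (rule abs_power_diff_le[OF t p])
    have "modulated g lam x ?s - modulated g lam x ?r
        = (g (x - ?s) - g (x - ?r)) * exp (\<i> * complex_of_real (lam * ?s))
          + g (x - ?r) * (exp (\<i> * complex_of_real (lam * ?s)) - exp (\<i> * complex_of_real (lam * ?r)))"
      by (simp add: modulated_def algebra_simps)
    also have "norm \<dots> \<le> norm (g (x - ?s) - g (x - ?r)) * 1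
        + norm (g (x - ?r)) * norm (exp (\<i> * complex_of_real (lam * ?s)) - exp (\<i> * complex_of_real (lam * ?r)))"
      by (rule norm_triangle_le) (simp add: norm_mult)
    also have "\<dots> \<le> K * (2 * t) * 1 + K * (\<Lambda> * (2 * t))"
    proof (intro add_mono mult_mono gK)
      have "norm (g (x - ?s) - g (x - ?r)) \<le> K * \<bar>(x - ?s) - (x - ?r)\<bar>" by (rule K(3))
      also have "\<dots> \<le> K * (2 * t)" using sr K(1) by (intro mult_left_mono) auto
      finally show "norm (g (x - ?s) - g (x - ?r)) \<le> K * (2 * t)" .
      have "norm (exp (\<i> * complex_of_real (lam * ?s)) - exp (\<i> * complex_of_real (lam * ?r)))
          \<le> \<bar>lam\<bar> * \<bar>?s - ?r\<bar>"
        using norm_cis_diff_le[of "lam * ?s" "lam * ?r"] by (simp flip: abs_mult right_diff_distrib)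
      also have "\<dots> \<le> \<Lambda> * (2 * t)" using sr lam \<Lambda> by (intro mult_mono) auto
      finally show "norm (exp (\<i> * complex_of_real (lam * ?s)) - exp (\<i> * complex_of_real (lam * ?r)))
          \<le> \<Lambda> * (2 * t)" .
    qed (use K t in auto)
    finally have m: "norm (modulated g lam x ?s - modulated g lam x ?r) \<le> 2 * K * t * (1 + \<Lambda>)"
      by (simp add: algebra_simps)
    have "h t * modulated g lam x ?s - h (- t) * modulated g lam x ?r
        = (h t - h (- t)) * modulated g lam x ?s + h (- t) * (modulated g lam x ?s - modulated g lam x ?r)"
      by (simp add: algebra_simps)
    also have "norm \<dots> \<le> norm (h t - h (- t)) * norm (modulated g lam x ?s)
        + norm (h (- t)) * norm (modulated g lam x ?s - modulated g lam x ?r)"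
      by (rule norm_triangle_le) (simp add: norm_mult)
    also have "\<dots> \<le> (2 * M * t) * K + M * (2 * K * t * (1 + \<Lambda>))"
      using t M K(1) by (intro add_mono mult_mono h m mK) auto
    also have "\<dots> = 4 * K * M * (1 + \<Lambda> / 2) * t" by (simp add: algebra_simps)
    also have "\<dots> \<le> 4 * K * M * (1 + x\<^sup>2 + \<Lambda>) * t"
      using K(1) M \<Lambda> t by (intro mult_right_mono mult_left_mono) auto
    finally show ?thesis .
  qed
qed

lemma pv_controlled_schwartz_modulated:
  assumes "schwartz g"
  obtains A where "\<And>lam. \<bar>lam\<bar> \<le> \<Lambda> \<Longrightarrow> pv_controlled A (modulated g lam x)"
proof -
  obtain K where K: "0 \<le> K" "\<And>x. norm (g x) \<le> K / (1 + x\<^sup>2)"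
    "\<And>x y. norm (g x - g y) \<le> K * \<bar>x - y\<bar>"
    using schwartz_decay_lipschitz[OF assms] by blast
  show thesis
  proof (rule that)
    fix lam :: real assume "\<bar>lam\<bar> \<le> \<Lambda>"
    then have "pv_controlled (4 * K * 1 * (1 + x\<^sup>2 + \<Lambda>)) (\<lambda>t. 1 * modulated g lam x (t ^ 1))"
      using assms by (intro pv_controlled_modulated K) auto
    then show "pv_controlled (4 * K * 1 * (1 + x\<^sup>2 + \<Lambda>)) (modulated g lam x)" by simp
  qed
qed

lemma pv_controlled_twisted:
  assumes "schwartz g" "1 \<le> p" "1 \<le> q"
  obtains A where "\<And>c. 0 \<le> c \<Longrightarrow> c \<le> 1 \<Longrightarrow> pv_controlled A (twisted p q g c lam x u)"
proof -
  obtain K where K: "0 \<le> K" "\<And>x. norm (g x) \<le> K / (1 + x\<^sup>2)"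
    "\<And>x y. norm (g x - g y) \<le> K * \<bar>x - y\<bar>"
    using schwartz_decay_lipschitz[OF assms(1)] by blast
  show thesis
  proof (rule that)
    fix c :: real assume c: "0 \<le> c" "c \<le> 1"
    show "pv_controlled (4 * K * K * (1 + x\<^sup>2 + \<bar>lam\<bar>)) (twisted p q g c lam x u)"
      unfolding twisted_def[abs_def]
    proof (intro pv_controlled_modulated K)
      show [measurable]: "g \<in> borel_measurable borel" using assms by auto
      show "(\<lambda>t. g (u - c * t ^ q)) \<in> borel_measurable borel" by measurable
      fix t :: real
      have "K / (1 + (u - c * t ^ q)\<^sup>2) \<le> K"
        using K(1) by (simp add: divide_le_eq mult_le_cancel_left1 add_pos_nonneg)
      then show "norm (g (u - c * t ^ q)) \<le> K" using K(2)[of "u - c * t ^ q"] by linarith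
      assume t: "0 \<le> t" "t \<le> 1"
      have "norm (g (u - c * t ^ q) - g (u - c * (- t) ^ q)) \<le> K * \<bar>c * (t ^ q - (- t) ^ q)\<bar>"
        using K(3)[of "u - c * t ^ q" "u - c * (- t) ^ q"] by (simp add: algebra_simps abs_minus_commute)
      also have "\<dots> = K * (c * \<bar>t ^ q - (- t) ^ q\<bar>)" using c by (simp add: abs_mult)
      also have "\<dots> \<le> K * (1 * (2 * t))"
        using K(1) c t assms by (intro mult_left_mono mult_mono abs_power_diff_le) auto
      finally show "norm (g (u - c * t ^ q) - g (u - c * (- t) ^ q)) \<le> 2 * K * t" by simp
    qed (use assms in auto)
  qed
qed

text \<open>Flattening one factor of the tensor product: \<open>g(u - c t^q)\<close> becomes the constant \<open>g(u)\<close>.\<close>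
lemma twisted_limit:
  assumes g: "schwartz g" and p: "odd p" and q: "1 \<le> q"
    and c: "\<And>n::nat. 0 \<le> c n" "\<And>n. c n \<le> 1" "c \<longlonglongrightarrow> 0"
  shows "(\<lambda>n. half_line_integral (twisted p q g (c n) lam x u))
    \<longlonglongrightarrow> g u * half_line_integral (modulated g lam x) / of_nat p"
proof -
  have p1: "1 \<le> p" using p by (cases p) auto
  obtain A where A: "\<And>c. 0 \<le> c \<Longrightarrow> c \<le> 1 \<Longrightarrow> pv_controlled A (twisted p q g c lam x u)"
    using pv_controlled_twisted[OF g p1 q] by blast
  obtain A' where A': "pv_controlled A' (modulated g lam x)"
    using pv_controlled_schwartz_modulated[OF g, of "\<bar>lam\<bar>"] by blast
  have "isCont g u" using schwartz_continuous[OF g, of UNIV] by (simp add: continuous_on_eq_continuous_at)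
  have "(\<lambda>n. half_line_integral (twisted p q g (c n) lam x u))
     \<longlonglongrightarrow> half_line_integral (\<lambda>t. g u * modulated g lam x (t ^ p))"
  proof (rule half_line_integral_tendsto)
    show "pv_controlled A (twisted p q g (c n) lam x u)" for n by (rule A[OF c(1,2)])
    fix t
    have "(\<lambda>n. u - c n * t ^ q) \<longlonglongrightarrow> u - 0 * t ^ q" by (intro tendsto_intros c)
    then have "(\<lambda>n. g (u - c n * t ^ q)) \<longlonglongrightarrow> g u"
      using isCont_tendsto_compose[OF \<open>isCont g u\<close>] by simp
    then show "(\<lambda>n. twisted p q g (c n) lam x u t) \<longlonglongrightarrow> g u * modulated g lam x (t ^ p)"
      unfolding twisted_def by (intro tendsto_intros)
  qed
  also have "half_line_integral (\<lambda>t. g u * modulated g lam x (t ^ p))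
      = g u * half_line_integral (\<lambda>t. modulated g lam x (t ^ p))"
    unfolding half_line_integral_def right_diff_distrib[symmetric] times_divide_eq_right[symmetric]
    by (rule set_integral_mult_right)
  also have "\<dots> = g u * half_line_integral (modulated g lam x) / of_nat p"
    by (simp add: half_line_integral_odd_power[OF A' p])
  finally show ?thesis .
qed

section \<open>Measurability and norms\<close>
lemma half_line_integral_measurable:
  assumes "(\<lambda>(z, t). \<phi> z t) \<in> borel_measurable (M \<Otimes>\<^sub>M borel)"
  shows "(\<lambda>z. half_line_integral (\<phi> z)) \<in> borel_measurable M"
proof -
  have [measurable (raw)]: "(\<lambda>w. \<phi> (a w) (b w)) \<in> borel_measurable (M \<Otimes>\<^sub>M lborel)"
    if "a \<in> M \<Otimes>\<^sub>M lborel \<rightarrow>\<^sub>M M" "b \<in> M \<Otimes>\<^sub>M lborel \<rightarrow>\<^sub>M borel" for a b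
    using measurable_compose[OF measurable_Pair[OF that] assms] by simp
  show ?thesis
    unfolding half_line_integral_def set_lebesgue_integral_def
    by (rule lborel.borel_measurable_lebesgue_integral) (unfold split_beta', measurable)
qed

lemma L2_norm_square: "(L2_norm f)\<^sup>2 = (\<integral>\<^sup>+ x. (f x)\<^sup>2 \<partial>lborel)"
proof (cases "(\<integral>\<^sup>+ x. (f x)\<^sup>2 \<partial>lborel) = \<infinity>")
  case True
  then show ?thesis by (simp add: L2_norm_def nn_integral_completion power2_eq_square ennreal_top_mult)
next
  case False
  then have "(\<integral>\<^sup>+ x. (f x)\<^sup>2 \<partial>lborel) < top" by (simp add: top.not_eq_extremum)
  with False show ?thesis
    by (simp add: L2_norm_def nn_integral_completion ennreal_power)
qed

lemma ennreal_le_if_square_le: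
  fixes a b :: ennreal
  assumes "a\<^sup>2 \<le> b\<^sup>2"
  shows "a \<le> b"
proof (cases a; cases b)
  fix r s assume "a = ennreal r" "b = ennreal s" "0 \<le> r" "0 \<le> s"
  with assms show ?thesis by (auto simp: ennreal_power intro!: ennreal_leI intro: power2_le_imp_le)
next
  fix s assume "a = top" "b = ennreal s" "0 \<le> s"
  with assms show ?thesis by (simp add: ennreal_power top_unique power2_eq_square ennreal_top_mult flip: ennreal_mult)
qed auto

section \<open>Linearizing the supremum over frequencies\<close>
lemma carleson_eq_SUP_half_line:
  assumes g: "schwartz g"
  shows "carleson g x = (SUP lam. ennreal (norm (half_line_integral (modulated g lam x))))"
proof -
  have "pv_integral (\<lambda>t. g (x - t) * exp (\<i> * complex_of_real (lam * t)) / complex_of_real t)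
      = half_line_integral (modulated g lam x)" for lam
  proof -
    obtain A where "pv_controlled A (modulated g lam x)"
      using pv_controlled_schwartz_modulated[OF g, of "\<bar>lam\<bar>"] by blast
    from pv_integral_eq_half_line[OF this] show ?thesis by (simp add: modulated_def)
  qed
  then show ?thesis by (simp add: carleson_def)
qed

lemma half_line_integral_modulated_continuous:
  assumes g: "schwartz g" and lim: "l \<longlonglongrightarrow> lam"
  shows "(\<lambda>n. half_line_integral (modulated g (l n) x)) \<longlonglongrightarrow> half_line_integral (modulated g lam x)"
proof -
  obtain \<Lambda> where \<Lambda>: "\<And>n. \<bar>l n\<bar> \<le> \<Lambda>"
    using convergent_imp_Bseq[OF convergentI[OF lim]] unfolding Bseq_def by auto
  obtain A where A: "\<And>lam. \<bar>lam\<bar> \<le> \<Lambda> \<Longrightarrow> pv_controlled A (modulated g lam x)"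
    using pv_controlled_schwartz_modulated[OF g] by blast
  show ?thesis
  proof (rule half_line_integral_tendsto)
    show "pv_controlled A (modulated g (l n) x)" for n by (rule A[OF \<Lambda>])
    show "(\<lambda>n. modulated g (l n) x t) \<longlonglongrightarrow> modulated g lam x t" for t
      unfolding modulated_def by (intro tendsto_intros lim)
  qed
qed

lemma carleson_eq_SUP_rational:
  assumes g: "schwartz g" and r: "range r = (\<rat> :: real set)"
  shows "carleson g x = (SUP k. ennreal (norm (half_line_integral (modulated g (r k) x))))"
    (is "_ = ?S")
  unfolding carleson_eq_SUP_half_line[OF g]
proof (rule antisym)
  show "?S \<le> (SUP lam. ennreal (norm (half_line_integral (modulated g lam x))))"
    by (intro SUP_least SUP_upper) auto
  show "(SUP lam. ennreal (norm (half_line_integral (modulated g lam x)))) \<le> ?S"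
  proof (rule SUP_least)
    fix lam :: real
    have "lam \<in> closure \<rat>" by (simp add: Rats_closure_real)
    then obtain l where l: "\<And>n. l n \<in> \<rat>" "l \<longlonglongrightarrow> lam" unfolding closure_sequential by blast
    have "(\<lambda>n. ennreal (norm (half_line_integral (modulated g (l n) x))))
        \<longlonglongrightarrow> ennreal (norm (half_line_integral (modulated g lam x)))"
      by (intro tendsto_ennrealI tendsto_norm half_line_integral_modulated_continuous g l)
    then show "ennreal (norm (half_line_integral (modulated g lam x))) \<le> ?S"
    proof (rule LIMSEQ_le_const2)
      have "ennreal (norm (half_line_integral (modulated g (l n) x))) \<le> ?S" for n
      proof -
        from l(1)[of n] r obtain k where "l n = r k" by blast
        then show ?thesis by (auto intro: SUP_upper)
      qed
      then show "\<exists>N. \<forall>n\<ge>N. ennreal (norm (half_line_integral (modulated g (l n) x))) \<le> ?S" by blast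
    qed
  qed
qed

text \<open>A frequency at which \<open>V\<close> is largest among \<open>r 0, \<dots>, r n\<close>. Updating the previous choice only
  where the new frequency is strictly better keeps it measurable as a function of \<open>x\<close>.\<close>
primrec maximizing_choice :: "(real \<Rightarrow> real \<Rightarrow> real) \<Rightarrow> (nat \<Rightarrow> real) \<Rightarrow> nat \<Rightarrow> real \<Rightarrow> real" where
  "maximizing_choice V r 0 x = r 0"
| "maximizing_choice V r (Suc n) x =
     (if V (maximizing_choice V r n x) x < V (r (Suc n)) x then r (Suc n) else maximizing_choice V r n x)"

lemma maximizing_choice_ge:
  "k \<le> n \<Longrightarrow> V (r k) x \<le> V (maximizing_choice V r n x) x"
proof (induction n)
  case (Suc n)
  then show ?case by (cases "k = Suc n") auto
qed simp

text \<open>Monotone convergence along the maximizing choices. The square of the supremum is split as a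
  double supremum over pairs \<open>j\<close>, \<open>k\<close>, each of which is dominated by the choice at stage
  \<open>max j k\<close>.\<close>
lemma linearized_SUP_bound:
  fixes V :: "real \<Rightarrow> real \<Rightarrow> real" and r :: "nat \<Rightarrow> real"
  assumes V: "(\<lambda>(lam, x). V lam x) \<in> borel_measurable (borel \<Otimes>\<^sub>M borel)"
    and bound: "\<And>N. N \<in> borel_measurable borel \<Longrightarrow> (\<integral>\<^sup>+ x. (ennreal (V (N x) x))\<^sup>2 \<partial>lborel) \<le> B"
  shows "(\<integral>\<^sup>+ x. (SUP k. ennreal (V (r k) x))\<^sup>2 \<partial>lborel) \<le> B"
proof -
  let ?N = "maximizing_choice V r"
  let ?W = "\<lambda>n x. (ennreal (V (?N n x) x))\<^sup>2"
  have [measurable]: "(\<lambda>x. V (N x) x) \<in> borel_measurable borel" if "N \<in> borel_measurable borel" for N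
    using measurable_compose[OF measurable_Pair[OF that measurable_ident_sets[OF refl]] V] by simp
  have N [measurable]: "?N n \<in> borel_measurable borel" for n
  proof (induction n)
    case (Suc n)
    note [measurable] = Suc
    show ?case unfolding maximizing_choice.simps(2)[abs_def] by measurable
  qed (simp add: measurable_def)
  have mono: "V (?N m x) x \<le> V (?N n x) x" if "m \<le> n" for m n x
    using that by (induction n rule: dec_induct) auto
  have le: "(SUP k. ennreal (V (r k) x))\<^sup>2 \<le> (SUP n. ?W n x)" for x
  proof -
    have "ennreal (V (r j) x) * ennreal (V (r k) x) \<le> (SUP n. ?W n x)" for j k
    proof -
      have "ennreal (V (r j) x) * ennreal (V (r k) x) \<le> ?W (max j k) x"
        unfolding power2_eq_square by (intro mult_mono ennreal_leI maximizing_choice_ge) auto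
      also have "\<dots> \<le> (SUP n. ?W n x)" by (rule SUP_upper) simp
      finally show ?thesis .
    qed
    then show ?thesis
      unfolding power2_eq_square[of "SUP k. _ k"] SUP_mult_left_ennreal SUP_mult_right_ennreal
      by (intro SUP_least)
  qed
  have "(\<integral>\<^sup>+ x. (SUP k. ennreal (V (r k) x))\<^sup>2 \<partial>lborel) \<le> (\<integral>\<^sup>+ x. (SUP n. ?W n x) \<partial>lborel)"
    by (rule nn_integral_mono) (rule le)
  also have "\<dots> = (SUP n. \<integral>\<^sup>+ x. ?W n x \<partial>lborel)"
  proof (rule nn_integral_monotone_convergence_SUP)
    show "incseq ?W"
      unfolding incseq_def le_fun_def
      by (intro allI impI power_mono ennreal_leI) (simp_all only: mono zero_le)
  qed measurable
  also have "\<dots> \<le> B" by (intro SUP_least bound N)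
  finally show ?thesis .
qed

section \<open>Descent from the plane to the line\<close>
lemma schwartz_square_integral_finite:
  fixes g :: "real \<Rightarrow> complex"
  assumes g: "schwartz g"
  shows "(\<integral>\<^sup>+ x. (ennreal (norm (g x)))\<^sup>2 \<partial>lborel) < \<infinity>"
proof -
  obtain K where K: "0 \<le> K" "\<And>x. norm (g x) \<le> K / (1 + x\<^sup>2)"
    "\<And>x y. norm (g x - g y) \<le> K * \<bar>x - y\<bar>"
    using schwartz_decay_lipschitz[OF g] by blast
  have "(norm (g x))\<^sup>2 \<le> K\<^sup>2 / (1 + x\<^sup>2)" for x
  proof -
    have "(norm (g x))\<^sup>2 \<le> (K / (1 + x\<^sup>2))\<^sup>2" using K by (intro power_mono) simp_all
    also have "\<dots> = K\<^sup>2 / (1 + x\<^sup>2)\<^sup>2" by (simp add: power_divide)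
    also have "\<dots> \<le> K\<^sup>2 / (1 + x\<^sup>2)"
      using self_le_power[of "1 + x\<^sup>2" 2] by (intro divide_left_mono) (auto simp: add_pos_nonneg intro!: mult_pos_pos zero_less_power)
    finally show ?thesis .
  qed
  then have "(\<integral>\<^sup>+ x. (ennreal (norm (g x)))\<^sup>2 \<partial>lborel) \<le> (\<integral>\<^sup>+ x. ennreal (K\<^sup>2 / (1 + x\<^sup>2)) \<partial>lborel)"
    by (intro nn_integral_mono) (auto simp: ennreal_power intro!: ennreal_leI)
  also have "\<dots> < \<infinity>"
    using integrable_const_over_1_plus_square[of "K\<^sup>2"]
    by (subst nn_integral_eq_integral) (auto simp: add_nonneg_nonneg)
  finally show ?thesis .
qed

text \<open>Needed because the final estimate is divided by \<open>\<parallel>g\<parallel>\<^sup>2\<close>: if this vanishes, so does \<open>g\<close>, as an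
  open set of measure zero is empty.\<close>
lemma schwartz_square_integral_zero:
  fixes g :: "real \<Rightarrow> complex"
  assumes g: "schwartz g" and zero: "(\<integral>\<^sup>+ x. (ennreal (norm (g x)))\<^sup>2 \<partial>lborel) = 0"
  shows "g = (\<lambda>x. 0)"
proof -
  have [measurable]: "g \<in> borel_measurable borel" using g by auto
  have "AE x in lborel. g x = 0"
    using zero by (subst (asm) nn_integral_0_iff_AE) (auto simp: ennreal_power)
  then have "AE x in lebesgue. g x = 0" by (rule AE_completion)
  then have "negligible {x. g x \<noteq> 0}"
    by (simp add: negligible_iff_null_sets AE_iff_null_sets)
  moreover have "open {x. g x \<noteq> 0}"
    using schwartz_continuous[OF g, of UNIV] by (intro open_Collect_neq) auto
  ultimately have "{x. g x \<noteq> 0} = {}" using open_not_negligible by blast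
  then show ?thesis by auto
qed

lemma twisted_half_line_measurable:
  assumes g: "schwartz g" and [measurable]: "N \<in> borel_measurable borel"
  shows "(\<lambda>(x, u). half_line_integral (twisted p q g c (N x) x u)) \<in> borel_measurable (lborel \<Otimes>\<^sub>M lborel)"
proof -
  have [measurable]: "g \<in> borel_measurable borel" using g by auto
  show ?thesis
    unfolding split_beta'
    by (rule half_line_integral_measurable) (unfold split_beta' twisted_def, measurable)
qed

lemma modulated_half_line_measurable:
  assumes g: "schwartz g"
  shows "(\<lambda>(lam, x). half_line_integral (modulated g lam x)) \<in> borel_measurable (borel \<Otimes>\<^sub>M borel)"
proof -
  have [measurable]: "g \<in> borel_measurable borel" using g by auto
  show ?thesis
    unfolding split_beta'
    by (rule half_line_integral_measurable) (unfold split_beta', measurable)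
qed

text \<open>The central step: the limit function is a product of a function of \<open>x\<close> and \<open>g(u)\<close>, so its
  squared norm factors and one factor \<open>\<integral> \<bar>g\<bar>\<^sup>2\<close> cancels from Fatou's inequality.\<close>
lemma carleson_square_bound:
  assumes g: "schwartz g" and p: "odd p" and q: "1 \<le> q"
    and bound: "\<And>N n. N \<in> borel_measurable borel \<Longrightarrow>
      (\<integral>\<^sup>+ (x, u). (ennreal (norm (half_line_integral (twisted p q g (1 / real (Suc n)) (N x) x u))))\<^sup>2
          \<partial>(lborel \<Otimes>\<^sub>M lborel)) \<le> D * (\<integral>\<^sup>+ x. (ennreal (norm (g x)))\<^sup>2 \<partial>lborel)\<^sup>2"
  shows "carleson g \<in> borel_measurable borel"
    and "(\<integral>\<^sup>+ x. (carleson g x)\<^sup>2 \<partial>lborel) \<le> D * (of_nat p)\<^sup>2 * (\<integral>\<^sup>+ x. (ennreal (norm (g x)))\<^sup>2 \<partial>lborel)"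
proof -
  let ?V = "\<lambda>lam x. norm (half_line_integral (modulated g lam x))"
  let ?I = "\<integral>\<^sup>+ x. (ennreal (norm (g x)))\<^sup>2 \<partial>lborel"
  let ?T = "\<lambda>N n (x, u). (ennreal (norm (half_line_integral (twisted p q g (1 / real (Suc n)) (N x) x u))))\<^sup>2"
  have [measurable]: "g \<in> borel_measurable borel" using g by auto
  have V: "(\<lambda>(lam, x). ?V lam x) \<in> borel_measurable (borel \<Otimes>\<^sub>M borel)"
    using modulated_half_line_measurable[OF g] unfolding split_beta' by measurable
  have Vm [measurable]: "(\<lambda>x. ?V (N x) x) \<in> borel_measurable borel"
    if "N \<in> borel_measurable borel" for N
    using measurable_compose[OF measurable_Pair[OF that measurable_ident_sets[OF refl]] V] by simp
  obtain r :: "nat \<Rightarrow> real" where r: "range r = \<rat>"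
    using countable_rat range_from_nat_into[of "\<rat> :: real set"] by (metis Rats_0 empty_iff)
  show "carleson g \<in> borel_measurable borel"
    unfolding carleson_eq_SUP_rational[OF g r, abs_def] by measurable
  have p0: "p > 0" using p by (cases p) auto
  show "(\<integral>\<^sup>+ x. (carleson g x)\<^sup>2 \<partial>lborel) \<le> D * (of_nat p)\<^sup>2 * ?I"
  proof (cases "?I = 0")
    case True
    then have "g = (\<lambda>x. 0)" by (rule schwartz_square_integral_zero[OF g])
    then have "carleson g x = 0" for x
      unfolding carleson_eq_SUP_half_line[OF g]
      by (simp add: modulated_def half_line_integral_def set_lebesgue_integral_def)
    then show ?thesis by simp
  next
    case False
    have fin: "?I < \<infinity>" by (rule schwartz_square_integral_finite[OF g])
    show ?thesis
      unfolding carleson_eq_SUP_rational[OF g r]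
    proof (rule linearized_SUP_bound[OF V])
      fix N :: "real \<Rightarrow> real" assume N [measurable]: "N \<in> borel_measurable borel"
      let ?J = "\<integral>\<^sup>+ x. (ennreal (?V (N x) x))\<^sup>2 \<partial>lborel"
      have Tm: "?T N n \<in> borel_measurable (lborel \<Otimes>\<^sub>M lborel)" for n
        using twisted_half_line_measurable[OF g N, of p q "1 / real (Suc n)"]
        unfolding split_beta' by measurable
      have lim: "(\<lambda>n. ?T N n (x, u)) \<longlonglongrightarrow>
          ennreal ((?V (N x) x / real p)\<^sup>2) * (ennreal (norm (g u)))\<^sup>2" for x u
      proof -
        have "(\<lambda>n. half_line_integral (twisted p q g (1 / real (Suc n)) (N x) x u))
            \<longlonglongrightarrow> g u * half_line_integral (modulated g (N x) x) / of_nat p"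
          using LIMSEQ_inverse_real_of_nat by (intro twisted_limit g p q) (auto simp: inverse_eq_divide)
        then have "(\<lambda>n. ennreal ((norm (half_line_integral (twisted p q g (1 / real (Suc n)) (N x) x u)))\<^sup>2))
            \<longlonglongrightarrow> ennreal ((norm (g u * half_line_integral (modulated g (N x) x) / of_nat p))\<^sup>2)"
          by (intro tendsto_ennrealI tendsto_power tendsto_norm)
        then show ?thesis
          by (simp add: ennreal_power norm_mult norm_divide power_mult_distrib power_divide
                ennreal_mult[symmetric] mult_ac)
      qed
      have "ennreal (1 / (real p)\<^sup>2) * ?J * ?I
          = (\<integral>\<^sup>+ x. ennreal ((?V (N x) x / real p)\<^sup>2) * ?I \<partial>lborel)"
        by (simp add: nn_integral_cmult[symmetric] nn_integral_multc[symmetric] ennreal_power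
              ennreal_mult[symmetric] power_divide mult_ac)
      also have "\<dots> = (\<integral>\<^sup>+ x. \<integral>\<^sup>+ u. ennreal ((?V (N x) x / real p)\<^sup>2) * (ennreal (norm (g u)))\<^sup>2 \<partial>lborel \<partial>lborel)"
        by (simp add: nn_integral_cmult)
      also have "\<dots> = (\<integral>\<^sup>+ x. \<integral>\<^sup>+ u. liminf (\<lambda>n. ?T N n (x, u)) \<partial>lborel \<partial>lborel)"
        using lim_imp_Liminf[OF sequentially_bot lim] by (simp only:)
      also have "\<dots> = (\<integral>\<^sup>+ z. liminf (\<lambda>n. ?T N n z) \<partial>(lborel \<Otimes>\<^sub>M lborel))"
        by (intro lborel.nn_integral_fst borel_measurable_liminf Tm)
      also have "\<dots> \<le> liminf (\<lambda>n. \<integral>\<^sup>+ z. ?T N n z \<partial>(lborel \<Otimes>\<^sub>M lborel))"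
        by (rule nn_integral_liminf) (rule Tm)
      also have "\<dots> \<le> liminf (\<lambda>n. D * ?I\<^sup>2)"
        by (intro Liminf_mono always_eventually allI bound N)
      also have "\<dots> = D * ?I * ?I" by (simp add: Liminf_const power2_eq_square mult_ac)
      finally have "ennreal (1 / (real p)\<^sup>2) * ?J \<le> D * ?I"
        using False fin by (simp add: ennreal_mult_le_mult_iff mult.commute[of _ ?I])
      then have "(of_nat p)\<^sup>2 * (ennreal (1 / (real p)\<^sup>2) * ?J) \<le> (of_nat p)\<^sup>2 * (D * ?I)"
        by (rule mult_left_mono) simp
      moreover have "(of_nat p)\<^sup>2 * ennreal (1 / (real p)\<^sup>2) = 1"
        using p0 by (simp add: ennreal_of_nat_eq_real_of_nat ennreal_power ennreal_mult[symmetric])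
      ultimately show "?J \<le> D * (of_nat p)\<^sup>2 * ?I"
        by (simp flip: mult.assoc add: mult.commute[of D "(of_nat p)\<^sup>2"])
    qed
  qed
qed

lemma nn_integral_plane_scale_second:
  fixes f :: "real \<times> real \<Rightarrow> ennreal"
  assumes f [measurable]: "f \<in> borel_measurable (lborel \<Otimes>\<^sub>M lborel)" and c: "0 < c"
  shows "(\<integral>\<^sup>+ z. f z \<partial>(lborel \<Otimes>\<^sub>M lborel)) = ennreal c * (\<integral>\<^sup>+ (x, y). f (x, c * y) \<partial>lborel)"
proof -
  have [measurable]: "(\<lambda>u. f (x, u)) \<in> borel_measurable borel" for x
    using f by measurable
  have [measurable]: "(\<lambda>(x, y). f (x, c * y)) \<in> borel_measurable (lborel \<Otimes>\<^sub>M lborel)"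
    using f by measurable
  have "(\<integral>\<^sup>+ z. f z \<partial>(lborel \<Otimes>\<^sub>M lborel)) = (\<integral>\<^sup>+ x. \<integral>\<^sup>+ u. f (x, u) \<partial>lborel \<partial>lborel)"
    by (rule lborel.nn_integral_fst[symmetric]) measurable
  also have "\<dots> = (\<integral>\<^sup>+ x. ennreal c * (\<integral>\<^sup>+ y. f (x, c * y) \<partial>lborel) \<partial>lborel)"
    using c by (subst nn_integral_real_affine[where c=c and t=0]) auto
  also have "\<dots> = ennreal c * (\<integral>\<^sup>+ x. \<integral>\<^sup>+ y. f (x, c * y) \<partial>lborel \<partial>lborel)"
    by (rule nn_integral_cmult) measurable
  also have "(\<integral>\<^sup>+ x. \<integral>\<^sup>+ y. f (x, c * y) \<partial>lborel \<partial>lborel) = (\<integral>\<^sup>+ (x, y). f (x, c * y) \<partial>(lborel \<Otimes>\<^sub>M lborel))"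
    by (subst lborel.nn_integral_fst[symmetric]) auto
  finally show ?thesis by (simp add: lborel_prod)
qed

lemma nn_integral_plane_scale_swap:
  fixes f :: "real \<times> real \<Rightarrow> ennreal"
  assumes f [measurable]: "f \<in> borel_measurable (lborel \<Otimes>\<^sub>M lborel)" and c: "0 < c"
  shows "(\<integral>\<^sup>+ z. f z \<partial>(lborel \<Otimes>\<^sub>M lborel)) = ennreal c * (\<integral>\<^sup>+ (x, y). f (y, c * x) \<partial>lborel)"
proof -
  have [measurable]: "(\<lambda>(y, x). f (y, c * x)) \<in> borel_measurable (lborel \<Otimes>\<^sub>M lborel)"
    "(\<lambda>(x, y). f (y, c * x)) \<in> borel_measurable (lborel \<Otimes>\<^sub>M lborel)"
    using f by measurable
  have "(\<integral>\<^sup>+ (y, x). f (y, c * x) \<partial>(lborel \<Otimes>\<^sub>M lborel)) = (\<integral>\<^sup>+ (x, y). f (y, c * x) \<partial>(lborel \<Otimes>\<^sub>M lborel))"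
    by (subst lborel.nn_integral_fst[symmetric], simp, subst lborel_pair.nn_integral_snd[symmetric]) auto
  then show ?thesis using nn_integral_plane_scale_second[OF f c] by (simp add: lborel_prod)
qed

lemma nn_integral_tensor_square:
  fixes g :: "real \<Rightarrow> complex"
  assumes g: "schwartz g"
  shows "(\<integral>\<^sup>+ (x, u). (ennreal (norm (g x * g u)))\<^sup>2 \<partial>(lborel \<Otimes>\<^sub>M lborel))
     = (\<integral>\<^sup>+ x. (ennreal (norm (g x)))\<^sup>2 \<partial>lborel)\<^sup>2"
proof -
  have [measurable]: "g \<in> borel_measurable borel" using g by auto
  have "(\<integral>\<^sup>+ (x, u). (ennreal (norm (g x * g u)))\<^sup>2 \<partial>(lborel \<Otimes>\<^sub>M lborel))
     = (\<integral>\<^sup>+ x. \<integral>\<^sup>+ u. (ennreal (norm (g x)))\<^sup>2 * (ennreal (norm (g u)))\<^sup>2 \<partial>lborel \<partial>lborel)"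
    by (subst lborel.nn_integral_fst[symmetric]) (auto simp: norm_mult ennreal_mult power_mult_distrib)
  also have "\<dots> = (\<integral>\<^sup>+ x. (ennreal (norm (g x)))\<^sup>2 \<partial>lborel)\<^sup>2"
    by (simp add: nn_integral_cmult nn_integral_multc power2_eq_square)
  finally show ?thesis .
qed

section \<open>The planar operators on scaled tensor products\<close>
lemma H_op_tensor_scaled_second:
  assumes g: "schwartz g" and m: "1 \<le> m" and c: "0 \<le> c" "c \<le> 1"
  shows "H_op m 1 lam (scaled_tensor 1 c g) (x, y) = half_line_integral (twisted 1 m g c lam x (c * y))"
proof -
  obtain A where "pv_controlled A (twisted 1 m g c lam x (c * y))"
    using pv_controlled_twisted[OF g order_refl m] c by blast
  from pv_integral_eq_half_line[OF this] show ?thesis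
    by (simp add: H_op_def scaled_tensor_def twisted_def modulated_def algebra_simps)
qed

lemma H_op_tensor_scaled_first:
  assumes g: "schwartz g" and m: "1 \<le> m" and c: "0 \<le> c" "c \<le> 1"
  shows "H_op m m lam (scaled_tensor c 1 g) (x, y) = half_line_integral (twisted m 1 g c lam y (c * x))"
proof -
  obtain A where "pv_controlled A (twisted m 1 g c lam y (c * x))"
    using pv_controlled_twisted[OF g m order_refl] c by blast
  from pv_integral_eq_half_line[OF this] show ?thesis
    by (simp add: H_op_def scaled_tensor_def twisted_def modulated_def algebra_simps)
qed

lemma L2_bound_square_rescaled:
  assumes "L2_norm u \<le> C * L2_norm f"
  shows "a * (L2_norm u)\<^sup>2 \<le> C\<^sup>2 * (a * (L2_norm f)\<^sup>2)"
proof -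
  have "(L2_norm u)\<^sup>2 \<le> C\<^sup>2 * (L2_norm f)\<^sup>2"
    using assms by (simp flip: power_mult_distrib add: power_mono)
  from mult_left_mono[OF this, of a] show ?thesis by (simp add: mult_ac)
qed

lemma bounded_on_L2_carlesonI:
  assumes p: "odd p" and q: "1 \<le> q" and C: "C < \<infinity>"
    and bound: "\<And>g N n. schwartz g \<Longrightarrow> N \<in> borel_measurable borel \<Longrightarrow>
      (\<integral>\<^sup>+ (x, u). (ennreal (norm (half_line_integral (twisted p q g (1 / real (Suc n)) (N x) x u))))\<^sup>2
          \<partial>(lborel \<Otimes>\<^sub>M lborel)) \<le> C\<^sup>2 * (\<integral>\<^sup>+ x. (ennreal (norm (g x)))\<^sup>2 \<partial>lborel)\<^sup>2"
  shows "bounded_on_L2 carleson"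
  unfolding bounded_on_L2_def
proof (intro exI conjI allI impI)
  show "C * of_nat p < \<infinity>" using C by (simp add: ennreal_mult_less_top of_nat_less_top)
  fix g :: "real \<Rightarrow> complex" assume g: "schwartz g"
  note * = carleson_square_bound[OF g p q bound[OF g]]
  show "carleson g \<in> borel_measurable lebesgue"
    using *(1) by (simp add: measurable_completion)
  have "(L2_norm (carleson g))\<^sup>2 \<le> (C * of_nat p * L2_norm_complex g)\<^sup>2"
    using *(2) by (simp add: L2_norm_square power_mult_distrib)
  then show "L2_norm (carleson g) \<le> C * of_nat p * L2_norm_complex g"
    by (rule ennreal_le_if_square_le)
qed

theorem mainTheorem4:
  shows "(\<forall>m::nat. m \<ge> 1 \<longrightarrow>
            (\<exists>C::ennreal. C < \<infinity> \<and>
               (\<forall>N::real \<Rightarrow> real. \<forall>f::real \<times> real \<Rightarrow> complex.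
                  N \<in> borel_measurable lebesgue \<longrightarrow> schwartz f \<longrightarrow>
                  L2_norm_complex (A_op m 1 N f) \<le> C * L2_norm_complex f)) \<longrightarrow>
            bounded_on_L2 carleson)
       \<and> (\<forall>m::nat. m \<ge> 1 \<and> odd m \<longrightarrow>
            (\<exists>C::ennreal. C < \<infinity> \<and>
               (\<forall>N::real \<Rightarrow> real. \<forall>f::real \<times> real \<Rightarrow> complex.
                  N \<in> borel_measurable lebesgue \<longrightarrow> schwartz f \<longrightarrow>
                  L2_norm_complex (B_op m m N f) \<le> C * L2_norm_complex f)) \<longrightarrow>
            bounded_on_L2 carleson)"
proof (intro conjI allI impI; elim exE conjE)
  fix m :: nat and C :: ennreal
  assume m: "1 \<le> m" and C: "C < \<infinity>"
    and A: "\<forall>N f. N \<in> borel_measurable lebesgue \<longrightarrow> schwartz f \<longrightarrow>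
              L2_norm_complex (A_op m 1 N f) \<le> C * L2_norm_complex f"
  show "bounded_on_L2 carleson"
  proof (rule bounded_on_L2_carlesonI[OF _ m C, of 1])
    fix g :: "real \<Rightarrow> complex" and N :: "real \<Rightarrow> real" and n :: nat
    assume g: "schwartz g" and N: "N \<in> borel_measurable borel"
    have [measurable]: "g \<in> borel_measurable borel" using g by auto
    define c where "c = 1 / real (Suc n)"
    have c: "0 < c" "0 \<le> c" "c \<le> 1" by (auto simp: c_def)
    let ?F = "scaled_tensor 1 c g"
    let ?T = "\<lambda>(x, u). (ennreal (norm (half_line_integral (twisted 1 m g c (N x) x u))))\<^sup>2"
    have Tm: "?T \<in> borel_measurable (lborel \<Otimes>\<^sub>M lborel)"
      using twisted_half_line_measurable[OF g N] unfolding split_beta' by measurable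
    have "L2_norm_complex (A_op m 1 N ?F) \<le> C * L2_norm_complex ?F"
      using A N schwartz_scaled_tensor[OF g, of 1 c] c by (simp add: measurable_completion)
    then have le: "ennreal c * (L2_norm_complex (A_op m 1 N ?F))\<^sup>2 \<le> C\<^sup>2 * (ennreal c * (L2_norm_complex ?F)\<^sup>2)"
      by (rule L2_bound_square_rescaled)
    have op: "A_op m 1 N ?F = (\<lambda>(x, y). half_line_integral (twisted 1 m g c (N x) x (c * y)))"
      by (rule ext) (auto simp: A_op_def H_op_tensor_scaled_second[OF g m c(2,3)] simp del: One_nat_def)
    have lhs: "ennreal c * (L2_norm_complex (A_op m 1 N ?F))\<^sup>2 = (\<integral>\<^sup>+ z. ?T z \<partial>(lborel \<Otimes>\<^sub>M lborel))"
      unfolding nn_integral_plane_scale_second[OF Tm c(1)] L2_norm_square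
      by (simp add: op split_beta' del: One_nat_def)
    have "ennreal c * (L2_norm_complex ?F)\<^sup>2
        = (\<integral>\<^sup>+ (x, u). (ennreal (norm (g x * g u)))\<^sup>2 \<partial>(lborel \<Otimes>\<^sub>M lborel))"
      by (subst nn_integral_plane_scale_second[OF _ c(1)])
         (simp_all add: L2_norm_square scaled_tensor_def split_beta')
    with le lhs show "(\<integral>\<^sup>+ (x, u). (ennreal (norm (half_line_integral
          (twisted 1 m g (1 / real (Suc n)) (N x) x u))))\<^sup>2 \<partial>(lborel \<Otimes>\<^sub>M lborel))
        \<le> C\<^sup>2 * (\<integral>\<^sup>+ x. (ennreal (norm (g x)))\<^sup>2 \<partial>lborel)\<^sup>2"
      by (simp add: nn_integral_tensor_square[OF g] c_def)
  qed simp
next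
  fix m :: nat and C :: ennreal
  assume m: "1 \<le> m" "odd m" and C: "C < \<infinity>"
    and B: "\<forall>N f. N \<in> borel_measurable lebesgue \<longrightarrow> schwartz f \<longrightarrow>
              L2_norm_complex (B_op m m N f) \<le> C * L2_norm_complex f"
  show "bounded_on_L2 carleson"
  proof (rule bounded_on_L2_carlesonI[OF m(2) order_refl C])
    fix g :: "real \<Rightarrow> complex" and N :: "real \<Rightarrow> real" and n :: nat
    assume g: "schwartz g" and N: "N \<in> borel_measurable borel"
    have [measurable]: "g \<in> borel_measurable borel" using g by auto
    define c where "c = 1 / real (Suc n)"
    have c: "0 < c" "0 \<le> c" "c \<le> 1" by (auto simp: c_def)
    let ?F = "scaled_tensor c 1 g"
    let ?T = "\<lambda>(y, u). (ennreal (norm (half_line_integral (twisted m 1 g c (N y) y u))))\<^sup>2"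
    have Tm: "?T \<in> borel_measurable (lborel \<Otimes>\<^sub>M lborel)"
      using twisted_half_line_measurable[OF g N] unfolding split_beta' by measurable
    have "L2_norm_complex (B_op m m N ?F) \<le> C * L2_norm_complex ?F"
      using B N schwartz_scaled_tensor[OF g, of c 1] c by (simp add: measurable_completion)
    then have le: "ennreal c * (L2_norm_complex (B_op m m N ?F))\<^sup>2 \<le> C\<^sup>2 * (ennreal c * (L2_norm_complex ?F)\<^sup>2)"
      by (rule L2_bound_square_rescaled)
    have op: "B_op m m N ?F = (\<lambda>(x, y). half_line_integral (twisted m 1 g c (N y) y (c * x)))"
      by (rule ext) (auto simp: B_op_def H_op_tensor_scaled_first[OF g m(1) c(2,3)] simp del: One_nat_def)
    have lhs: "ennreal c * (L2_norm_complex (B_op m m N ?F))\<^sup>2 = (\<integral>\<^sup>+ z. ?T z \<partial>(lborel \<Otimes>\<^sub>M lborel))"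
      unfolding nn_integral_plane_scale_swap[OF Tm c(1)] L2_norm_square
      by (simp add: op split_beta' del: One_nat_def)
    have "ennreal c * (L2_norm_complex ?F)\<^sup>2
        = (\<integral>\<^sup>+ (y, u). (ennreal (norm (g y * g u)))\<^sup>2 \<partial>(lborel \<Otimes>\<^sub>M lborel))"
      by (subst nn_integral_plane_scale_swap[OF _ c(1)])
         (simp_all add: L2_norm_square scaled_tensor_def split_beta' mult.commute)
    with le lhs show "(\<integral>\<^sup>+ (y, u). (ennreal (norm (half_line_integral
          (twisted m 1 g (1 / real (Suc n)) (N y) y u))))\<^sup>2 \<partial>(lborel \<Otimes>\<^sub>M lborel))
        \<le> C\<^sup>2 * (\<integral>\<^sup>+ x. (ennreal (norm (g x)))\<^sup>2 \<partial>lborel)\<^sup>2"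
      by (simp add: nn_integral_tensor_square[OF g] c_def)
  qed
qed

end
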